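(* For all complex numbers $\mu, x$ with $|\mu|<1$ and $|x|<1$, $$\operatorname{Li}_2\left(\frac{(1+\mu)x}{1+x}\right) - \operatorname{Li}_2\left(\frac{x}{1+x}\right) = \sum_{n=1}^{\infty}\left\{\sum_{k=1}^{n}\frac{(-\mu)^k}{k}\right\}\frac{(-x)^n}{n}.$$
   Context: The dilogarithm is $\operatorname{Li}_2(z)=\sum_{n=1}^\infty \frac{z^n}{n^2}$ for $|z|\le 1$, extended holomorphically to $\mathbb{C}\setminus[1,\infty)$ (principal branch) when the argument lies outside the closed unit disk. *)

theory Defs
  imports "HOL-Complex_Analysis.Complex_Analysis"
begin

definition slit_plane :: "complex set" where
  "slit_plane = - complex_of_real ` {1..}"

definition dilog_series :: "complex \<Rightarrow> complex" where
  "dilog_series z = (\<Sum>n. z ^ Suc n / of_nat (Suc n) ^ 2)"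

text \<open>
  The continuation chosen below exists and is unique on \<^const>\<open>slit_plane\<close> (lemmas
  \<open>dilog_continuation_exists\<close> and \<open>dilog_unique\<close>), and it agrees with the series on the whole
  closed unit disk except the point 1, so that the two branches of the definition fit together
  (\<open>holomorphic_dilog\<close>). At real points greater than 1 the value of \<open>dilog\<close> is unspecified.
\<close>

definition dilog_continuation :: "complex \<Rightarrow> complex" where
  "dilog_continuation =
     (SOME f. f holomorphic_on slit_plane \<and> (\<forall>z\<in>ball 0 1. f z = dilog_series z))"

definition dilog :: "complex \<Rightarrow> complex" where
  "dilog z = (if norm z \<le> 1 then dilog_series z else dilog_continuation z)"

lemma slit_plane_iff: "z \<in> slit_plane \<longleftrightarrow> Im z \<noteq> 0 \<or> Re z < 1"
proof -
  have "z \<in> complex_of_real ` {1..} \<longleftrightarrow> Im z = 0 \<and> Re z \<ge> 1"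
    by (auto simp: image_iff complex_eq_iff)
  thus ?thesis by (auto simp: slit_plane_def)
qed

lemma slit_plane_iff_nonpos_Reals: "z \<in> slit_plane \<longleftrightarrow> 1 - z \<notin> \<real>\<^sub>\<le>\<^sub>0"
  by (auto simp: slit_plane_iff complex_nonpos_Reals_iff)

lemma open_slit_plane: "open slit_plane"
  unfolding slit_plane_def
  by (intro open_Compl closed_injective_linear_image closed_real_atLeast)
     (auto simp: linear_iff scaleR_conv_of_real inj_on_def)

lemma ball_subset_slit_plane: "ball 0 1 \<subseteq> slit_plane"
proof
  fix z :: complex assume "z \<in> ball 0 1"
  hence "Re z < 1" using complex_Re_le_cmod[of z] by simp
  thus "z \<in> slit_plane" by (simp add: slit_plane_iff)
qed

lemma starlike_slit_plane: "starlike slit_plane"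
  unfolding starlike_def
proof (intro bexI ballI subsetI)
  show "0 \<in> slit_plane" by (simp add: slit_plane_iff)
next
  fix z w assume z: "z \<in> slit_plane" and "w \<in> closed_segment 0 z"
  then obtain u where u: "0 \<le> u" "u \<le> 1" "w = u *\<^sub>R z"
    by (auto simp: in_segment)
  show "w \<in> slit_plane"
  proof (cases "Im z = 0")
    case True
    hence "Re z < 1" using z by (simp add: slit_plane_iff)
    hence "u * Re z < 1"
    proof (cases "Re z \<le> 0")
      case True
      thus ?thesis using u mult_nonneg_nonpos[of u "Re z"] by linarith
    next
      case False
      thus ?thesis using u mult_right_mono[of u 1 "Re z"] \<open>Re z < 1\<close> by linarith
    qed
    thus ?thesis by (simp add: slit_plane_iff u)
  next
    case False
    show ?thesis
      using False u by (cases "u = 0") (auto simp: slit_plane_iff)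
  qed
qed

lemma dilog_series_altdef: "dilog_series z = (\<Sum>n. (1 / of_nat n ^ 2) * z ^ n)"
  and summable_dilog_series: "summable (\<lambda>n. (1 / of_nat n ^ 2) * z ^ n)"
  if "norm z \<le> 1"
proof -
  have *: "summable (\<lambda>n. (1 / of_nat n ^ 2) * z ^ n)"
  proof (rule summable_comparison_test')
    show "summable (\<lambda>n. inverse (real n ^ 2))"
      by (rule inverse_power_summable) auto
    show "norm (1 / of_nat n ^ 2 * z ^ n) \<le> inverse (real n ^ 2)" if "n \<ge> 0" for n
      using divide_right_mono[OF power_le_one[of "norm z" n], of "real n ^ 2"] \<open>norm z \<le> 1\<close>
      by (simp add: norm_mult norm_divide norm_power inverse_eq_divide)
  qed
  show "summable (\<lambda>n. (1 / of_nat n ^ 2) * z ^ n)" by (rule *)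
  show "dilog_series z = (\<Sum>n. (1 / of_nat n ^ 2) * z ^ n)"
    using suminf_split_head[OF *] by (simp add: dilog_series_def)
qed

lemma continuous_on_dilog_series: "continuous_on (cball 0 1) dilog_series"
proof -
  have "uniformly_convergent_on (cball 0 1)
          (\<lambda>n z. \<Sum>i<n. (1 / of_nat i ^ 2) * (z::complex) ^ i)"
  proof (rule Weierstrass_m_test')
    show "summable (\<lambda>n. inverse (real n ^ 2))"
      by (rule inverse_power_summable) auto
    show "norm (1 / of_nat n ^ 2 * z ^ n) \<le> inverse (real n ^ 2)"
      if "z \<in> cball 0 1" for n and z :: complex
      using divide_right_mono[OF power_le_one[of "norm z" n], of "real n ^ 2"] that
      by (simp add: norm_mult norm_divide norm_power inverse_eq_divide)
  qed
  then obtain l where l: "uniform_limit (cball 0 1)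
      (\<lambda>n z. \<Sum>i<n. (1 / of_nat i ^ 2) * (z::complex) ^ i) l sequentially"
    by (auto simp: uniformly_convergent_on_def)
  have "continuous_on (cball 0 1) l"
    by (rule uniform_limit_theorem[OF _ l])
       (auto intro!: always_eventually continuous_on_sum continuous_on_mult continuous_on_const
          continuous_on_power continuous_on_id simp del: times_divide_eq_left)
  moreover have "l z = dilog_series z" if "z \<in> cball 0 1" for z
  proof -
    have "(\<lambda>i. (1 / of_nat i ^ 2) * z ^ i) sums l z"
      using tendsto_uniform_limitI[OF l that] by (simp add: sums_def)
    thus ?thesis using that by (simp add: dilog_series_altdef sums_iff)
  qed
  ultimately show ?thesis
    using continuous_on_cong[of "cball 0 1" "cball 0 1" l dilog_series] by simp
qed

lemma has_field_derivative_dilog_series: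
  assumes "norm z < 1"
  shows "(dilog_series has_field_derivative (if z = 0 then 1 else -Ln (1 - z) / z)) (at z)"
proof -
  let ?c = "\<lambda>n. 1 / of_nat n ^ 2 :: complex"
  have D: "((\<lambda>z. \<Sum>n. ?c n * z ^ n) has_field_derivative (\<Sum>n. diffs ?c n * z ^ n)) (at z)"
    by (rule termdiffs_strong'[of 1]) (use assms summable_dilog_series in force)+
  have c: "diffs ?c n = 1 / of_nat (Suc n)" for n
    unfolding diffs_def power2_eq_square using of_nat_neq_0[of n, where ?'a = complex]
    by (simp del: of_nat_Suc)
  have "(\<Sum>n. diffs ?c n * z ^ n) = (if z = 0 then 1 else -Ln (1 - z) / z)"
  proof (cases "z = 0")
    case True
    thus ?thesis using powser_zero[of "diffs ?c"] c[of 0] by simp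
  next
    case False
    have "(\<lambda>n. - (z ^ n) / of_nat n) sums Ln (1 - z)"
      using Ln_series'[of "-z"] assms by simp
    hence "(\<lambda>n. - (z ^ Suc n) / of_nat (Suc n)) sums Ln (1 - z)"
      by (subst sums_Suc_iff) simp
    hence "(\<lambda>n. (-1 / z) * (- (z ^ Suc n) / of_nat (Suc n))) sums ((-1 / z) * Ln (1 - z))"
      by (rule sums_mult)
    also have "(\<lambda>n. (-1 / z) * (- (z ^ Suc n) / of_nat (Suc n))) = (\<lambda>n. diffs ?c n * z ^ n)"
      using False by (simp add: c fun_eq_iff del: of_nat_Suc)
    finally show ?thesis using False by (simp add: sums_iff)
  qed
  with D have D': "((\<lambda>z. \<Sum>n. ?c n * z ^ n) has_field_derivative
      (if z = 0 then 1 else -Ln (1 - z) / z)) (at z)" by simp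
  show ?thesis
    by (rule has_field_derivative_transform_within_open[OF D', of "ball 0 1"])
       (use assms in \<open>auto simp: dilog_series_altdef\<close>)
qed

lemma dilog_continuation_exists:
  "\<exists>f. f holomorphic_on slit_plane \<and> (\<forall>z\<in>ball 0 1. f z = dilog_series z)"
proof -
  define g where "g = (\<lambda>z::complex. if z = 0 then 1 else -Ln (1 - z) / z)"
  have "(\<lambda>z. -Ln (1 - z)) holomorphic_on slit_plane"
    by (auto intro!: holomorphic_intros simp: slit_plane_iff_nonpos_Reals)
  moreover have "deriv (\<lambda>z. -Ln (1 - z)) 0 = 1"
    by (rule DERIV_imp_deriv) (auto intro!: derivative_eq_intros)
  ultimately have hol: "g holomorphic_on slit_plane"
    by (intro pole_theorem_open_0[of "\<lambda>z. -Ln (1 - z)" slit_plane 0 g] open_slit_plane)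
       (auto simp: g_def)
  obtain F where F: "\<And>z. z \<in> slit_plane \<Longrightarrow> (F has_field_derivative g z) (at z)"
    using holomorphic_starlike_primitive[of slit_plane g "{}"] hol open_slit_plane
      starlike_slit_plane holomorphic_on_imp_continuous_on[OF hol]
    by (auto simp: holomorphic_on_open field_differentiable_def)
  have "\<exists>c. \<forall>z\<in>ball 0 1. F z - dilog_series z = c"
  proof (rule has_field_derivative_zero_constant)
    fix z :: complex assume z: "z \<in> ball 0 1"
    have "(F has_field_derivative g z) (at z)"
      using F z ball_subset_slit_plane by blast
    from DERIV_diff[OF this has_field_derivative_dilog_series[of z]] z
    have "((\<lambda>z. F z - dilog_series z) has_field_derivative 0) (at z)"
      by (simp add: g_def split: if_splits)
    thus "((\<lambda>z. F z - dilog_series z) has_field_derivative 0) (at z within ball 0 1)"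
      by (rule has_field_derivative_at_within)
  qed auto
  then obtain c where c: "\<And>z. z \<in> ball 0 1 \<Longrightarrow> F z - dilog_series z = c" by blast
  have "F holomorphic_on slit_plane"
    using F open_slit_plane by (auto simp: holomorphic_on_open)
  hence "(\<lambda>z. F z - c) holomorphic_on slit_plane"
    by (intro holomorphic_intros)
  moreover have "F z - c = dilog_series z" if "z \<in> ball 0 1" for z
    using c[OF that] by (simp add: algebra_simps)
  ultimately show ?thesis by blast
qed

lemma holomorphic_dilog_continuation: "dilog_continuation holomorphic_on slit_plane"
  and dilog_continuation_eq_series: "z \<in> ball 0 1 \<Longrightarrow> dilog_continuation z = dilog_series z"
  using someI_ex[OF dilog_continuation_exists] unfolding dilog_continuation_def by blast+

lemma dilog_eq_continuation:
  assumes "z \<in> slit_plane"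
  shows "dilog z = dilog_continuation z"
proof (cases "norm z \<le> 1")
  case True
  have z1: "z \<noteq> 1" using assms by (auto simp: slit_plane_iff)
  define u where "u = (\<lambda>n. of_real (1 - inverse (real (Suc n))) * z)"
  have lim: "u \<longlonglongrightarrow> z"
    unfolding u_def
    by (rule tendsto_eq_intros LIMSEQ_inverse_real_of_nat refl)+ simp
  have ball: "u n \<in> ball 0 1" for n
  proof -
    have "norm (u n) = (1 - inverse (real (Suc n))) * norm z"
      unfolding u_def norm_mult norm_of_real by (simp add: field_simps)
    also have "\<dots> \<le> (1 - inverse (real (Suc n))) * 1"
      by (intro mult_left_mono True) (simp add: field_simps)
    also have "\<dots> < 1" by simp
    finally show ?thesis by simp
  qed
  have "(\<lambda>n. dilog_series (u n)) \<longlonglongrightarrow> dilog_series z"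
    by (rule continuous_on_tendsto_compose[OF continuous_on_dilog_series lim])
       (use True ball in \<open>auto intro!: always_eventually less_imp_le\<close>)
  moreover have "(\<lambda>n. dilog_continuation (u n)) \<longlonglongrightarrow> dilog_continuation z"
    by (rule continuous_on_tendsto_compose[OF
          holomorphic_on_imp_continuous_on[OF holomorphic_dilog_continuation] lim])
       (use assms ball ball_subset_slit_plane in \<open>auto intro!: always_eventually\<close>)
  ultimately have "dilog_series z = dilog_continuation z"
    using ball by (auto simp: dilog_continuation_eq_series intro: LIMSEQ_unique)
  thus ?thesis using True by (simp add: dilog_def)
qed (simp add: dilog_def)

lemma holomorphic_dilog: "dilog holomorphic_on slit_plane"
  using holomorphic_dilog_continuation dilog_eq_continuation
  by (simp cong: holomorphic_cong)

lemma dilog_unique: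
  assumes "f holomorphic_on slit_plane" and "\<And>z. z \<in> ball 0 1 \<Longrightarrow> f z = dilog_series z"
    and "z \<in> slit_plane"
  shows "f z = dilog z"
proof (rule analytic_continuation_open[where g = dilog])
  show "open (ball 0 1 :: complex set)" "ball 0 1 \<noteq> ({} :: complex set)" by auto
  show "connected slit_plane"
    by (rule starlike_imp_connected[OF starlike_slit_plane])
  show "f w = dilog w" if "w \<in> ball 0 1" for w
    using assms(2)[OF that] that by (simp add: dilog_def)
qed (use assms holomorphic_dilog ball_subset_slit_plane open_slit_plane in auto)

end

theory Submission
  imports Defs
begin

text \<open>
  Both sides are holomorphic in \<open>x\<close> on the unit disk and vanish at \<open>x = 0\<close>, so it suffices to
  compare derivatives. The dilogarithm satisfies \<open>z Li\<^sub>2'(z) = - Ln (1 - z)\<close> on the slit plane,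
  and the Moebius substitution \<open>w = (1 + \<mu>) x / (1 + x)\<close> has the two convenient properties
  \<open>1 - w = (1 - \<mu> x) / (1 + x)\<close> and \<open>x w' = w / (1 + x)\<close>. Hence
  \<open>x d/dx Li\<^sub>2(w) = - (Ln (1 - \<mu> x) - Ln (1 + x)) / (1 + x)\<close>
  (\<open>has_field_derivative_dilog_moebius\<close>). The second term on the left of the claim is the case
  \<open>\<mu> = 0\<close>, and subtracting it cancels \<open>Ln (1 + x)\<close>, which leaves
  \<open>- Ln (1 - \<mu> x) / (1 + x)\<close>.

  On the other side, applying \<open>x d/dx\<close> to the series removes the factor \<open>1 / n\<close>. What remains is
  the generating function of the partial sums of \<open>(-\<mu>)\<^sup>k / k\<close>, which is the Cauchy
  product of the logarithm series with the geometric series, hence again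
  \<open>- Ln (1 - \<mu> x) / (1 + x)\<close> (\<open>sums_log_partial_sums\<close>).
\<close>

section \<open>The differential equation of the dilogarithm\<close>

text \<open>
  On the unit disk this is read off from the power series; it persists on the slit plane by
  analytic continuation. Keeping the factor \<open>z\<close> on the left avoids the removable singularity
  at 0.
\<close>
lemma mult_deriv_dilog:
  assumes "z \<in> slit_plane"
  shows "z * deriv dilog z = - Ln (1 - z)"
proof (rule analytic_continuation_open[where f = "\<lambda>z. z * deriv dilog z"])
  show "open (ball 0 1 :: complex set)" "ball 0 1 \<noteq> ({} :: complex set)" by auto
  show "connected slit_plane"
    by (rule starlike_imp_connected[OF starlike_slit_plane])
  show "(\<lambda>z. z * deriv dilog z) holomorphic_on slit_plane"
    by (intro holomorphic_intros holomorphic_deriv holomorphic_dilog open_slit_plane)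
  show "(\<lambda>z. - Ln (1 - z)) holomorphic_on slit_plane"
    by (auto intro!: holomorphic_intros simp: slit_plane_iff_nonpos_Reals)
  show "w * deriv dilog w = - Ln (1 - w)" if w: "w \<in> ball 0 1" for w
  proof -
    have "(dilog has_field_derivative (if w = 0 then 1 else -Ln (1 - w) / w)) (at w)"
      by (rule has_field_derivative_transform_within_open[OF
            has_field_derivative_dilog_series, of _ "ball 0 1"])
         (use w in \<open>auto simp: dilog_def\<close>)
    thus ?thesis by (auto dest!: DERIV_imp_deriv)
  qed
qed (use assms ball_subset_slit_plane open_slit_plane in auto)

section \<open>The substitution\<close>

lemma Ln_divide_Re_pos:
  assumes "0 < Re u" "0 < Re v"
  shows "Ln (u / v) = Ln u - Ln v"
proof -
  have nz: "u \<noteq> 0" "v \<noteq> 0" using assms by auto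
  have "\<bar>Im (Ln u)\<bar> < pi / 2" "\<bar>Im (Ln v)\<bar> < pi / 2"
    using assms nz Re_Ln_pos_lt by blast+
  hence "Ln (exp (Ln u - Ln v)) = Ln u - Ln v"
    by (intro Ln_exp) auto
  thus ?thesis using nz by (simp add: exp_diff)
qed

lemma divide_notin_nonpos_Reals_Re_pos:
  fixes u v :: complex
  assumes "0 < Re u" "0 < Re v"
  shows "u / v \<notin> \<real>\<^sub>\<le>\<^sub>0"
proof
  assume "u / v \<in> \<real>\<^sub>\<le>\<^sub>0"
  then obtain t where t: "t \<le> 0" "u / v = of_real t"
    by (auto elim: nonpos_Reals_cases)
  have "v \<noteq> 0" using assms by auto
  hence "u = of_real t * v" using t by (simp add: field_simps)
  hence "Re u = t * Re v" by simp
  thus False using assms t mult_nonpos_nonneg[of t "Re v"] by linarith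
qed

lemma Re_one_plus_pos: "0 < Re (1 + z)" if "norm z < 1" for z :: complex
  using abs_Re_le_cmod[of z] that by simp

lemma norm_mult_less_one:
  fixes \<mu> x :: complex
  assumes "norm \<mu> \<le> 1" "norm x < 1"
  shows "norm (\<mu> * x) < 1"
  using assms mult_right_mono[of "norm \<mu>" 1 "norm x"] by (simp add: norm_mult)

lemma one_minus_moebius:
  fixes \<mu> x :: complex
  assumes "1 + x \<noteq> 0"
  shows "1 - (1 + \<mu>) * x / (1 + x) = (1 - \<mu> * x) / (1 + x)"
  using assms by (simp add: field_simps)

text \<open>
  Both \<open>1 - \<mu> x\<close> and \<open>1 + x\<close> lie in the right half plane, so their quotient avoids the
  nonpositive reals.
\<close>
lemma moebius_in_slit_plane:
  assumes "norm \<mu> \<le> 1" "norm x < 1"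
  shows "(1 + \<mu>) * x / (1 + x) \<in> slit_plane"
proof -
  have "0 < Re (1 + x)" "0 < Re (1 - \<mu> * x)"
    using Re_one_plus_pos[of x] Re_one_plus_pos[of "- (\<mu> * x)"] norm_mult_less_one[OF assms] assms
    by simp_all
  moreover from this have "1 + x \<noteq> 0" by (metis less_irrefl zero_complex.sel(1))
  ultimately show ?thesis
    by (simp add: slit_plane_iff_nonpos_Reals one_minus_moebius divide_notin_nonpos_Reals_Re_pos)
qed

text \<open>
  The Euler operator \<open>x d/dx\<close> turns the chain rule factor into \<open>x w' = w / (1 + x)\<close>, whose \<open>w\<close>
  is exactly the one required by the differential equation.
\<close>
lemma has_field_derivative_dilog_moebius:
  assumes "norm \<mu> \<le> 1" "norm x < 1"
  obtains D where
    "((\<lambda>x. dilog ((1 + \<mu>) * x / (1 + x))) has_field_derivative D) (at x)"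
    "x * D = - (Ln (1 - \<mu> * x) - Ln (1 + x)) / (1 + x)"
proof -
  define w where "w = (1 + \<mu>) * x / (1 + x)"
  have Re: "0 < Re (1 + x)" "0 < Re (1 - \<mu> * x)"
    using Re_one_plus_pos[of x] Re_one_plus_pos[of "- (\<mu> * x)"] norm_mult_less_one[OF assms] assms
    by simp_all
  hence nz: "1 + x \<noteq> 0" by (metis less_irrefl zero_complex.sel(1))
  have w: "w \<in> slit_plane"
    unfolding w_def by (rule moebius_in_slit_plane[OF assms])
  have "(dilog has_field_derivative deriv dilog w) (at w)"
    by (rule holomorphic_derivI[OF holomorphic_dilog open_slit_plane w])
  moreover have "((\<lambda>x. (1 + \<mu>) * x / (1 + x)) has_field_derivative (1 + \<mu>) / (1 + x) ^ 2) (at x)"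
    by (rule derivative_eq_intros refl nz)+ (use nz in \<open>simp add: field_simps power2_eq_square\<close>)
  ultimately have D: "((\<lambda>x. dilog ((1 + \<mu>) * x / (1 + x))) has_field_derivative
      deriv dilog w * ((1 + \<mu>) / (1 + x) ^ 2)) (at x)"
    unfolding w_def by (rule DERIV_chain2)
  have "x * (deriv dilog w * ((1 + \<mu>) / (1 + x) ^ 2)) = (w * deriv dilog w) / (1 + x)"
    by (simp add: w_def power2_eq_square)
  also have "\<dots> = - Ln ((1 - \<mu> * x) / (1 + x)) / (1 + x)"
    using mult_deriv_dilog[OF w] one_minus_moebius[OF nz, of \<mu>] by (simp add: w_def)
  also have "\<dots> = - (Ln (1 - \<mu> * x) - Ln (1 + x)) / (1 + x)"
    using Re by (simp add: Ln_divide_Re_pos)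
  finally show ?thesis using D that by blast
qed

section \<open>The series of partial sums\<close>

definition log_partial_sum :: "complex \<Rightarrow> nat \<Rightarrow> complex" where
  "log_partial_sum \<mu> n = (\<Sum>k=1..n. (-\<mu>) ^ k / of_nat k)"

lemma norm_log_partial_sum_le:
  assumes "norm \<mu> \<le> 1"
  shows "norm (log_partial_sum \<mu> n) \<le> real n"
proof -
  have "norm ((-\<mu>) ^ k / of_nat k) \<le> 1" if "k \<in> {1..n}" for k
  proof -
    have "norm \<mu> ^ k \<le> real k"
      using power_le_one[of "norm \<mu>" k] assms that by force
    thus ?thesis using that by (simp add: norm_divide norm_power divide_le_eq)
  qed
  from sum_norm_le[of "{1..n}", OF this] show ?thesis by (simp add: log_partial_sum_def)
qed

text \<open>
  Multiplying a power series by \<open>1 / (1 - y) = 1 + y + y\<^sup>2 + \<dots>\<close> replaces its coefficients by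
  their partial sums; here \<open>y = - x\<close>.
\<close>
lemma sums_log_partial_sums:
  assumes "norm \<mu> \<le> 1" "norm x < 1"
  shows "(\<lambda>n. log_partial_sum \<mu> n * (-x) ^ n) sums (- Ln (1 - \<mu> * x) / (1 + x))"
proof -
  let ?a = "\<lambda>n. (\<mu> * x) ^ n / of_nat n" and ?b = "\<lambda>n. (-x) ^ n"
  have mx: "norm (\<mu> * x) < 1" by (rule norm_mult_less_one[OF assms])
  have a: "?a sums (- Ln (1 - \<mu> * x))"
    using sums_minus[OF Ln_series'[of "- (\<mu> * x)"]] mx by simp
  have b: "?b sums (1 / (1 + x))"
    using geometric_sums[of "-x"] assms by simp
  have "summable (\<lambda>n. norm (?a n))"
  proof (rule summable_comparison_test')
    show "summable (\<lambda>n. norm (\<mu> * x) ^ n)" using mx by (simp add: summable_geometric)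
    show "norm (norm (?a n)) \<le> norm (\<mu> * x) ^ n" if "n \<ge> 0" for n
      by (cases "n = 0") (auto simp: norm_divide norm_power divide_le_eq mult_le_cancel_left1)
  qed
  moreover have "summable (\<lambda>n. norm (?b n))"
    using assms by (simp add: norm_power summable_geometric)
  ultimately have "(\<lambda>n. \<Sum>i\<le>n. ?a i * ?b (n - i)) sums ((\<Sum>n. ?a n) * (\<Sum>n. ?b n))"
    by (rule Cauchy_product_sums)
  also have "(\<Sum>n. ?a n) * (\<Sum>n. ?b n) = - Ln (1 - \<mu> * x) / (1 + x)"
    using a b by (simp add: sums_iff)
  also have "(\<lambda>n. \<Sum>i\<le>n. ?a i * ?b (n - i)) = (\<lambda>n. log_partial_sum \<mu> n * (-x) ^ n)"
  proof
    fix n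
    have "?a i * ?b (n - i) = (-\<mu>) ^ i / of_nat i * (-x) ^ n" if "i \<le> n" for i
    proof -
      have "(-x) ^ n = (-x) ^ i * (-x) ^ (n - i)"
        using that by (simp flip: power_add)
      moreover have "(\<mu> * x) ^ i = (-\<mu>) ^ i * (-x) ^ i"
        by (simp flip: power_mult_distrib)
      ultimately show ?thesis by simp
    qed
    hence "(\<Sum>i\<le>n. ?a i * ?b (n - i)) = (\<Sum>i\<le>n. (-\<mu>) ^ i / of_nat i) * (-x) ^ n"
      unfolding sum_distrib_right by (intro sum.cong) auto
    \<comment> \<open>The summand for \<open>i = 0\<close> vanishes because division by zero yields zero.\<close>
    also have "(\<Sum>i\<le>n. (-\<mu>) ^ i / of_nat i) = log_partial_sum \<mu> n"
      unfolding log_partial_sum_def by (rule sum.mono_neutral_right) (auto simp: not_le)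
    finally show "(\<Sum>i\<le>n. ?a i * ?b (n - i)) = log_partial_sum \<mu> n * (-x) ^ n" .
  qed
  finally show ?thesis .
qed

text \<open>
  The coefficient \<open>log_partial_sum \<mu> n (-1)\<^sup>n / n\<close> has norm at most 1, so the series
  converges on the unit disk and may be differentiated termwise.
\<close>
lemma has_field_derivative_log_partial_sum_series:
  fixes \<mu> :: complex
  assumes "norm \<mu> \<le> 1"
  defines "c \<equiv> \<lambda>n. log_partial_sum \<mu> n * (-1) ^ n / of_nat n"
  shows "norm x < 1 \<Longrightarrow> summable (\<lambda>n. c n * x ^ n)"
    and "norm x < 1 \<Longrightarrow> \<exists>D. ((\<lambda>x. \<Sum>n. c n * x ^ n) has_field_derivative D) (at x) \<and>
           x * D = - Ln (1 - \<mu> * x) / (1 + x)"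
proof -
  have summ: "summable (\<lambda>n. c n * x ^ n)" if x: "norm x < 1" for x
  proof (rule summable_comparison_test')
    show "summable (\<lambda>n. norm x ^ n)" using x by (simp add: summable_geometric)
    show "norm (c n * x ^ n) \<le> norm x ^ n" if "n \<ge> 0" for n
    proof -
      have "norm (c n) \<le> 1"
        using norm_log_partial_sum_le[OF assms(1), of n]
        by (cases "n = 0") (simp_all add: c_def norm_mult norm_divide norm_power divide_le_eq)
      from mult_right_mono[OF this, of "norm x ^ n"] show ?thesis
        by (simp add: norm_mult norm_power)
    qed
  qed
  show "summable (\<lambda>n. c n * x ^ n)" if "norm x < 1" using summ that .
  show "\<exists>D. ((\<lambda>x. \<Sum>n. c n * x ^ n) has_field_derivative D) (at x) \<and>
      x * D = - Ln (1 - \<mu> * x) / (1 + x)" if x: "norm x < 1"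
  proof (intro exI conjI)
    show "((\<lambda>x. \<Sum>n. c n * x ^ n) has_field_derivative (\<Sum>n. diffs c n * x ^ n)) (at x)"
      by (rule termdiffs_strong'[of 1]) (use x summ in auto)
    have "summable (\<lambda>n. diffs c n * x ^ n)"
      by (rule termdiff_converges[of _ 1]) (use x summ in auto)
    hence "(\<lambda>n. x * (diffs c n * x ^ n)) sums (x * (\<Sum>n. diffs c n * x ^ n))"
      by (intro sums_mult summable_sums)
    also have "(\<lambda>n. x * (diffs c n * x ^ n)) =
        (\<lambda>n. log_partial_sum \<mu> (Suc n) * (-x) ^ Suc n)"
    proof
      fix n
      have "diffs c n = log_partial_sum \<mu> (Suc n) * (-1) ^ Suc n"
        using of_nat_neq_0[of n, where ?'a = complex] by (simp add: diffs_def c_def del: of_nat_Suc)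
      thus "x * (diffs c n * x ^ n) = log_partial_sum \<mu> (Suc n) * (-x) ^ Suc n"
        by (simp add: power_minus[of x n])
    qed
    finally have "(\<lambda>n. log_partial_sum \<mu> n * (-x) ^ n) sums (x * (\<Sum>n. diffs c n * x ^ n))"
      by (subst (asm) sums_Suc_iff) (simp add: log_partial_sum_def)
    from sums_unique2[OF this sums_log_partial_sums[OF assms(1) x]]
    show "x * (\<Sum>n. diffs c n * x ^ n) = - Ln (1 - \<mu> * x) / (1 + x)" .
  qed
qed

section \<open>The dilogarithm identity\<close>

theorem proposition10:
  fixes \<mu> x :: complex
  assumes "norm \<mu> < 1" and "norm x < 1"
  shows "(\<lambda>n. (\<Sum>k=1..Suc n. (-\<mu>) ^ k / of_nat k) * ((-x) ^ Suc n / of_nat (Suc n)))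
           sums (dilog ((1 + \<mu>) * x / (1 + x)) - dilog (x / (1 + x)))"
proof -
  define c where "c = (\<lambda>n. log_partial_sum \<mu> n * (-1) ^ n / of_nat n)"
  define P where "P = (\<lambda>x. \<Sum>n. c n * x ^ n)"
  define H where "H = (\<lambda>x. dilog ((1 + \<mu>) * x / (1 + x)) - dilog (x / (1 + x)) - P x)"
  have mu: "norm \<mu> \<le> 1" using assms by simp
  note series = has_field_derivative_log_partial_sum_series[OF mu]
  have H': "\<exists>D. (H has_field_derivative D) (at z) \<and> z * D = 0" if z: "z \<in> ball 0 1" for z
  proof -
    have z: "norm z < 1" using z by simp
    obtain D1 where D1: "((\<lambda>x. dilog ((1 + \<mu>) * x / (1 + x))) has_field_derivative D1) (at z)"
      "z * D1 = - (Ln (1 - \<mu> * z) - Ln (1 + z)) / (1 + z)"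
      by (rule has_field_derivative_dilog_moebius[OF mu z])
    obtain D2 where D2: "((\<lambda>x. dilog (x / (1 + x))) has_field_derivative D2) (at z)"
      "z * D2 = - (0 - Ln (1 + z)) / (1 + z)"
      using has_field_derivative_dilog_moebius[of 0 z] z by auto
    obtain D3 where D3: "(P has_field_derivative D3) (at z)"
      "z * D3 = - Ln (1 - \<mu> * z) / (1 + z)"
      using series(2)[OF z] unfolding P_def c_def by blast
    have "(H has_field_derivative D1 - D2 - D3) (at z)"
      unfolding H_def by (intro DERIV_diff D1 D2 D3)
    moreover have "z * (D1 - D2 - D3) = 0"
      using D1(2) D2(2) D3(2)
      by (simp add: right_diff_distrib flip: diff_divide_distrib)
    ultimately show ?thesis by blast
  qed
  \<comment> \<open>The Euler operator gives no information at the origin, where continuity suffices.\<close>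
  have "H x = H 0"
  proof -
    have "continuous_on (ball 0 1) H"
      using H' by (meson DERIV_isCont continuous_at_imp_continuous_on)
    moreover have "\<forall>z\<in>ball 0 1 - {0}. (H has_field_derivative 0) (at z)"
      using H' by fastforce
    ultimately obtain k where "\<And>z. z \<in> ball 0 1 \<Longrightarrow> H z = k"
      using DERIV_zero_connected_constant[of "ball 0 1" "{0}" H] by auto
    thus ?thesis using assms by simp
  qed
  moreover have "H 0 = 0"
    using powser_zero[of c] by (simp add: H_def P_def c_def)
  ultimately have "P x = dilog ((1 + \<mu>) * x / (1 + x)) - dilog (x / (1 + x))"
    by (simp add: H_def)
  hence "(\<lambda>n. c n * x ^ n) sums (dilog ((1 + \<mu>) * x / (1 + x)) - dilog (x / (1 + x)))"
    using summable_sums[OF series(1)[OF assms(2)]] by (simp add: P_def c_def)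
  hence "(\<lambda>n. c (Suc n) * x ^ Suc n) sums
      (dilog ((1 + \<mu>) * x / (1 + x)) - dilog (x / (1 + x)))"
    by (subst sums_Suc_iff) (simp add: c_def)
  moreover have "c n * x ^ n = log_partial_sum \<mu> n * ((-x) ^ n / of_nat n)" for n
    by (simp add: c_def power_minus[of x n])
  ultimately show ?thesis by (simp only: log_partial_sum_def)
qed

end
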